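(* Let $f$ and $g$ be entire functions of $n$ complex variables with index-pairs $(m,q)$ and $(m,p)$ respectively, where $m,p,q$ are integers with $m\ge q\ge 1$ and $m\ge p\ge 1$, and let $D$ be a bounded complete $n$-circular domain with center at the origin in $\mathbb{C}^n$. Assume $\lambda_g(m,p)>0$, so that all growth indicators below are defined. Then $$\left[\frac{\overline{\Delta}_{f,D}(m,q)}{\overline{\tau}_{g,D}(m,p)}\right]^{\frac1{\lambda_g(m,p)}}\le \overline{\Delta}_{g,D}^{(p,q)}(f)\le\min\left\{\left[\frac{\overline{\Delta}_{f,D}(m,q)}{\overline{\Delta}_{g,D}(m,p)}\right]^{\frac1{\rho_g(m,p)}},\left[\frac{\Delta_{f,D}(m,q)}{\Delta_{g,D}(m,p)}\right]^{\frac1{\rho_g(m,p)}}\right\}.$$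
   Context: All entire functions are transcendental. A bounded complete $n$-circular domain with center at the origin is a nonempty bounded open set $D\subset\mathbb{C}^n$ such that $z\in D$ and $|w_j|\le|z_j|$ for $1\le j\le n$ imply $w\in D$. For $f$ entire on $\mathbb{C}^n$ and $R>0$, $M_{f,D}(R)=\sup\{|f(z)|: z/R\in D\}$; it is strictly increasing and has an inverse $M_{f,D}^{-1}:(|f(0)|,\infty)\to(0,\infty)$ tending to infinity. $M_{g,D}^{-1}M_{f,D}(R)$ means $M_{g,D}^{-1}(M_{f,D}(R))$. $\log^{[0]}x=x$, $\log^{[k]}x=\log(\log^{[k-1]}x)$. Orders: $\rho_f(m,q)=\limsup_{R\to\infty}\frac{\log^{[m]}M_{f,D}(R)}{\log^{[q]}R}$ and $\lambda_f(m,q)$ is the corresponding $\liminf$; these do not depend on $D$. $f$ has index-pair $(1,1)$ if $0<\rho_f(1,1)<\infty$; otherwise $f$ has index-pair $(m,q)\ne(1,1)$, $m\ge q\ge1$, if $\delta_{m-q,0}<\rho_f(m,q)<\infty$ and $\rho_f(m-1,q-1)$ is not a positive real number, where $\delta_{i,j}=1$ if $i=j$ and $0$ otherwise. Types: for $0<\rho_f(m,q)<\infty$, $\Delta_{f,D}(m,q)$ and $\overline{\Delta}_{f,D}(m,q)$ are respectively the $\limsup$ and the $\liminf$ as $R\to\infty$ of $\frac{\log^{[m-1]}M_{f,D}(R)}{[\log^{[q-1]}R]^{\rho_f(m,q)}}$. For $0<\lambda_f(m,q)<\infty$, $\tau_{f,D}(m,q)$ and $\overline{\tau}_{f,D}(m,q)$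 are respectively the $\liminf$ and the $\limsup$ of $\frac{\log^{[m-1]}M_{f,D}(R)}{[\log^{[q-1]}R]^{\lambda_f(m,q)}}$. (Likewise for $g$ with $(m,p)$. Note the bar denotes a $\liminf$ for $\Delta$ and a $\limsup$ for $\tau$.) Relative order: $\rho_g^{(p,q)}(f)=\limsup_{R\to\infty}\frac{\log^{[p]}M_{g,D}^{-1}M_{f,D}(R)}{\log^{[q]}R}$ (independent of $D$). Relative lower type: for $0<\rho_g^{(p,q)}(f)<\infty$, $\overline{\Delta}_{g,D}^{(p,q)}(f)=\liminf_{R\to\infty}\frac{\log^{[p-1]}M_{g,D}^{-1}M_{f,D}(R)}{[\log^{[q-1]}R]^{\rho_g^{(p,q)}(f)}}$. Convention: types lie in $[0,\infty]$; $a/0=\infty$ for $a>0$, $a/\infty=0$ for $a<\infty$; indeterminate quotients $0/0$, $\infty/\infty$ are omitted (no assertion is made about them). *)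

theory Defs
  imports "HOL-Analysis.Analysis"
begin

text \<open>Complex differentiability: the (real) Frechet derivative exists and is complex linear.\<close>

definition entire :: "(complex ^ 'n \<Rightarrow> complex) \<Rightarrow> bool" where
  "entire f \<longleftrightarrow>
     (\<forall>z. \<exists>f'. (f has_derivative f') (at z) \<and> (\<forall>c v. f' (c *s v) = c * f' v))"

definition polynomial_map :: "(complex ^ 'n \<Rightarrow> complex) \<Rightarrow> bool" where
  "polynomial_map f \<longleftrightarrow>
     (\<exists>(S :: ('n \<Rightarrow> nat) set) c. finite S \<and>
        (\<forall>z. f z = (\<Sum>\<alpha>\<in>S. c \<alpha> * (\<Prod>j\<in>UNIV. (z $ j) ^ \<alpha> j))))"

definition transcendental_entire :: "(complex ^ 'n \<Rightarrow> complex) \<Rightarrow> bool" where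
  "transcendental_entire f \<longleftrightarrow> entire f \<and> \<not> polynomial_map f"

definition bounded_complete_circular_domain :: "(complex ^ 'n) set \<Rightarrow> bool" where
  "bounded_complete_circular_domain D \<longleftrightarrow>
     D \<noteq> {} \<and> bounded D \<and> open D \<and>
     (\<forall>z\<in>D. \<forall>w. (\<forall>j. norm (w $ j) \<le> norm (z $ j)) \<longrightarrow> w \<in> D)"

definition max_mod :: "(complex ^ 'n \<Rightarrow> complex) \<Rightarrow> (complex ^ 'n) set \<Rightarrow> real \<Rightarrow> real" where
  "max_mod f D R = Sup {norm (f z) | z. z /\<^sub>R R \<in> D}"

text \<open>Meaningful for arguments greater than \<open>norm (f 0)\<close>.\<close>

definition max_mod_inv :: "(complex ^ 'n \<Rightarrow> complex) \<Rightarrow> (complex ^ 'n) set \<Rightarrow> real \<Rightarrow> real" where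
  "max_mod_inv f D = the_inv_into {0<..} (max_mod f D)"

text \<open>The iterated logarithm is only ever used in limits at infinity, where its argument is
  eventually so large that all intermediate logarithms are positive; the totalised values of
  \<open>ln\<close> at nonpositive arguments play no role.\<close>

definition iter_log :: "nat \<Rightarrow> real \<Rightarrow> real" where
  "iter_log k = ln ^^ k"

text \<open>The orders do not depend on the domain, but their defining formulas mention it.\<close>

definition growth_order ::
    "(complex ^ 'n \<Rightarrow> complex) \<Rightarrow> (complex ^ 'n) set \<Rightarrow> nat \<Rightarrow> nat \<Rightarrow> ereal" where
  "growth_order f D m q =
     Limsup at_top (\<lambda>R. ereal (iter_log m (max_mod f D R) / iter_log q R))"

definition growth_lower_order ::
    "(complex ^ 'n \<Rightarrow> complex) \<Rightarrow> (complex ^ 'n) set \<Rightarrow> nat \<Rightarrow> nat \<Rightarrow> ereal" where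
  "growth_lower_order f D m q =
     Liminf at_top (\<lambda>R. ereal (iter_log m (max_mod f D R) / iter_log q R))"

definition pos_finite :: "ereal \<Rightarrow> bool" where
  "pos_finite x \<longleftrightarrow> 0 < x \<and> x < \<infinity>"

definition has_index_pair ::
    "(complex ^ 'n \<Rightarrow> complex) \<Rightarrow> (complex ^ 'n) set \<Rightarrow> nat \<Rightarrow> nat \<Rightarrow> bool" where
  "has_index_pair f D m q \<longleftrightarrow>
     (if pos_finite (growth_order f D 1 1) then m = 1 \<and> q = 1
      else (m, q) \<noteq> (1, 1) \<and> m \<ge> q \<and> q \<ge> 1 \<and>
        (if m = q then 1 else 0) < growth_order f D m q \<and> growth_order f D m q < \<infinity> \<and>
        \<not> pos_finite (growth_order f D (m - 1) (q - 1)))"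

text \<open>The common quotient of the types, with a growth exponent as parameter. The types
  \<open>type_Delta\<close>, \<open>type_Delta_bar\<close> are meaningful if the order is positive and finite,
  \<open>type_tau_bar\<close> if the lower order is. The bar denotes a lower limit for Delta, but an
  upper limit for tau.\<close>

definition type_quotient ::
    "(complex ^ 'n \<Rightarrow> complex) \<Rightarrow> (complex ^ 'n) set \<Rightarrow> nat \<Rightarrow> nat \<Rightarrow> real \<Rightarrow> real \<Rightarrow> ereal" where
  "type_quotient f D m q a R =
     ereal (iter_log (m - 1) (max_mod f D R) / (iter_log (q - 1) R) powr a)"

definition type_Delta ::
    "(complex ^ 'n \<Rightarrow> complex) \<Rightarrow> (complex ^ 'n) set \<Rightarrow> nat \<Rightarrow> nat \<Rightarrow> ereal" where
  "type_Delta f D m q =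
     Limsup at_top (type_quotient f D m q (real_of_ereal (growth_order f D m q)))"

definition type_Delta_bar ::
    "(complex ^ 'n \<Rightarrow> complex) \<Rightarrow> (complex ^ 'n) set \<Rightarrow> nat \<Rightarrow> nat \<Rightarrow> ereal" where
  "type_Delta_bar f D m q =
     Liminf at_top (type_quotient f D m q (real_of_ereal (growth_order f D m q)))"

definition type_tau_bar ::
    "(complex ^ 'n \<Rightarrow> complex) \<Rightarrow> (complex ^ 'n) set \<Rightarrow> nat \<Rightarrow> nat \<Rightarrow> ereal" where
  "type_tau_bar f D m q =
     Limsup at_top (type_quotient f D m q (real_of_ereal (growth_lower_order f D m q)))"

text \<open>Growth of \<open>f\<close> relative to \<open>g\<close>; the first function argument is \<open>g\<close>.\<close>

definition rel_order ::
    "(complex ^ 'n \<Rightarrow> complex) \<Rightarrow> (complex ^ 'n) set \<Rightarrow> nat \<Rightarrow> nat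
      \<Rightarrow> (complex ^ 'n \<Rightarrow> complex) \<Rightarrow> ereal" where
  "rel_order g D p q f =
     Limsup at_top (\<lambda>R. ereal (iter_log p (max_mod_inv g D (max_mod f D R)) / iter_log q R))"

definition rel_type_Delta_bar ::
    "(complex ^ 'n \<Rightarrow> complex) \<Rightarrow> (complex ^ 'n) set \<Rightarrow> nat \<Rightarrow> nat
      \<Rightarrow> (complex ^ 'n \<Rightarrow> complex) \<Rightarrow> ereal" where
  "rel_type_Delta_bar g D p q f =
     Liminf at_top (\<lambda>R. ereal (iter_log (p - 1) (max_mod_inv g D (max_mod f D R))
        / (iter_log (q - 1) R) powr real_of_ereal (rel_order g D p q f)))"

text \<open>On nonnegative arguments, division on \<^typ>\<open>ereal\<close> satisfies \<open>a / 0 = \<infinity>\<close> for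
  \<open>a > 0\<close> and \<open>a / \<infinity> = 0\<close> for \<open>a < \<infinity>\<close>. It totalises \<open>0 / 0\<close> and \<open>\<infinity> / \<infinity>\<close>,
  which are therefore excluded explicitly.\<close>

definition determinate_quotient :: "ereal \<Rightarrow> ereal \<Rightarrow> bool" where
  "determinate_quotient a b \<longleftrightarrow> \<not> (a = 0 \<and> b = 0) \<and> \<not> (a = \<infinity> \<and> b = \<infinity>)"

text \<open>Power with positive real exponent on the extended nonnegative reals.\<close>

definition ext_powr :: "ereal \<Rightarrow> real \<Rightarrow> ereal" where
  "ext_powr x a = (if x = \<infinity> then \<infinity> else ereal (real_of_ereal x powr a))"

end

theory Submission
  imports Defs "HOL-Complex_Analysis.Conformal_Mappings"
begin

text \<open>Let \<open>h = max_mod_inv g D \<circ> max_mod f D\<close>, so that \<open>g\<close> has at the radius \<open>h R\<close> the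
  maximum modulus that \<open>f\<close> has at \<open>R\<close>. With
  \<open>F R = iter_log (m - 1) (max_mod f D R)\<close>, \<open>x R = iter_log (q - 1) R\<close> and
  \<open>y R = iter_log (p - 1) (h R)\<close>, the growth indicators of \<open>f\<close> compare \<open>F\<close> with powers of
  \<open>x\<close>, those of \<open>g\<close> compare the same \<open>F\<close> with powers of \<open>y\<close>, and those of \<open>f\<close> relative
  to \<open>g\<close> compare \<open>y\<close> with powers of \<open>x\<close>. So the statement concerns a single function
  measured on two scales.

  Write \<open>rf\<close>, \<open>rg\<close> for the orders of \<open>f\<close> and \<open>g\<close>, \<open>lg\<close> for the lower order of \<open>g\<close>, and
  \<open>r\<close> for the relative order. Taking limits in
  \<open>ln y / ln x = (ln F / ln x) / (ln F / ln y)\<close> gives \<open>rf / rg \<le> r \<le> rf / lg\<close>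
  (\<open>Limsup_ln_scale_bounds\<close>). Taking limits in
  \<open>y powr s / x powr rf = (F / x powr rf) / (F / y powr s)\<close>, with \<open>s = lg\<close> or \<open>s = rg\<close>,
  bounds the lower limit of \<open>y / x powr (rf / s)\<close> by \<open>s\<close>-th roots of quotients of types.
  The two inequalities for \<open>r\<close> point in just the direction that lets \<open>r\<close> replace
  \<open>rf / s\<close>: below with \<open>s = lg\<close>, above with \<open>s = rg\<close> (\<open>scale_type_lower_bound\<close>,
  \<open>scale_type_upper_bound_Liminf\<close> and \<open>scale_type_upper_bound_Limsup\<close>).

  To view the indicators of \<open>g\<close>, which are limits over the radius of \<open>g\<close>, as limits over
  \<open>R\<close>, the map \<open>h\<close> must be a bijection near infinity (\<open>filtermap_transition\<close>). This is where
  function theory enters: the maximum modulus is continuous, strictly increasing by the maximum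
  modulus principle, and unbounded by Liouville's theorem, both applied on complex lines
  through the origin.\<close>

section \<open>Lower and upper limits of quotients\<close>

lemma Liminf_filtermap_ereal:
  fixes u :: "'b \<Rightarrow> ereal"
  shows "Liminf (filtermap h G) u = Liminf G (\<lambda>x. u (h x))"
proof (rule antisym)
  show "Liminf G (\<lambda>x. u (h x)) \<le> Liminf (filtermap h G) u"
    unfolding le_Liminf_iff eventually_filtermap by (auto dest: less_LiminfD)
qed (rule Liminf_filtermap_le)

lemma Limsup_filtermap_ereal:
  fixes u :: "'b \<Rightarrow> ereal"
  shows "Limsup (filtermap h G) u = Limsup G (\<lambda>x. u (h x))"
proof (rule antisym)
  show "Limsup (filtermap h G) u \<le> Limsup G (\<lambda>x. u (h x))"
    unfolding Limsup_le_iff eventually_filtermap by (auto dest: Limsup_lessD)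
qed (rule Limsup_filtermap_ge)

lemma frequently_greater_of_less_Limsup:
  fixes u :: "'b \<Rightarrow> ereal"
  assumes "c < Limsup G u" shows "frequently (\<lambda>x. c < u x) G"
  unfolding frequently_def
proof
  assume "eventually (\<lambda>x. \<not> c < u x) G"
  then have "Limsup G u \<le> c"
    by (intro Limsup_bounded) (auto elim: eventually_mono)
  with assms show False by simp
qed

lemma frequently_less_of_Liminf_less:
  fixes u :: "'b \<Rightarrow> ereal"
  assumes "Liminf G u < c" shows "frequently (\<lambda>x. u x < c) G"
  unfolding frequently_def
proof
  assume "eventually (\<lambda>x. \<not> u x < c) G"
  then have "Liminf G u \<ge> c"
    by (intro Liminf_bounded) (auto elim: eventually_mono)
  with assms show False by simp
qed

lemma ereal_mult_less_of_less_divide: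
  fixes a b :: ereal
  assumes "0 < c" "ereal c < a / b" "0 \<le> a" "0 \<le> b" "determinate_quotient a b"
  shows "ereal c * b < a"
  using assms
  by (cases a; cases b) (auto simp: determinate_quotient_def field_simps split: if_splits)

lemma ereal_less_mult_of_divide_less:
  fixes a b :: ereal
  assumes "0 < c" "a / b < ereal c" "0 \<le> a" "0 \<le> b" "determinate_quotient a b"
  shows "a < ereal c * b"
  using assms
  by (cases a; cases b) (auto simp: determinate_quotient_def field_simps split: if_splits)

lemma ereal_divide_nonneg:
  fixes a b :: ereal
  assumes "0 \<le> a" "0 \<le> b" shows "0 \<le> a / b"
  using assms by (cases a; cases b; cases "b = 0") auto

lemma ereal_between_of_not_le:
  fixes a b :: ereal
  assumes "\<not> a \<le> b" shows "\<exists>c. b < ereal c \<and> ereal c < a"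
  using assms ereal_dense2 by (simp add: not_le)

text \<open>The number \<open>u\<close> turns a bound on a quotient of limits into separate bounds on numerator
  and denominator, \<open>u\<close> and \<open>u / c\<close>, both strict and therefore inherited by the functions
  themselves. All five inequalities between limits of quotients rest on this lemma and the next.\<close>

lemma separate_of_less_divide:
  fixes a b :: ereal
  assumes "0 < c" "ereal c < a / b" "0 \<le> a" "0 \<le> b" "determinate_quotient a b"
  obtains u where "ereal u < a" "b < ereal (u / c)"
proof -
  obtain u where "ereal c * b < ereal u" "ereal u < a"
    using ereal_dense2[OF ereal_mult_less_of_less_divide[OF assms]] by blast
  moreover from this have "b < ereal (u / c)"
    using assms(1,4) by (cases b) (auto simp: field_simps)
  ultimately show ?thesis using that by blast
qed

lemma separate_of_divide_less:
  fixes a b :: ereal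
  assumes "0 < c" "a / b < ereal c" "0 \<le> a" "0 \<le> b" "determinate_quotient a b"
  obtains u where "a < ereal u" "ereal (u / c) < b"
proof -
  obtain u where "ereal u < ereal c * b" "a < ereal u"
    using ereal_dense2[OF ereal_less_mult_of_divide_less[OF assms]] by blast
  moreover from this have "ereal (u / c) < b"
    using assms(1,4) by (cases b) (auto simp: field_simps)
  ultimately show ?thesis using that by blast
qed

text \<open>In each of the following inequalities a counterexample would leave room for a real number
  \<open>c\<close> strictly between the two sides. Separating numerator and denominator at \<open>u\<close> and
  \<open>u / c\<close> then puts \<open>a x / b x\<close> on one side of \<open>c\<close>, and the position of its own limit
  puts it on the other. These are three conditions on \<open>x\<close>; they meet because the combination
  of upper and lower limits is such that at most one of them holds only frequently and the
  others hold eventually.\<close>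

context
  fixes G :: "'a filter" and a b :: "'a \<Rightarrow> real"
  assumes nontriv: "G \<noteq> bot"
    and apos: "eventually (\<lambda>x. 0 < a x) G" and bpos: "eventually (\<lambda>x. 0 < b x) G"
begin

private lemma nonneg:
  "0 \<le> Liminf G (\<lambda>x. ereal (a x))" "0 \<le> Limsup G (\<lambda>x. ereal (a x))"
  "0 \<le> Liminf G (\<lambda>x. ereal (b x))" "0 \<le> Limsup G (\<lambda>x. ereal (b x))"
  "0 \<le> Liminf G (\<lambda>x. ereal (a x / b x))" "0 \<le> Limsup G (\<lambda>x. ereal (a x / b x))"
proof -
  have *: "0 \<le> Liminf G (\<lambda>x. ereal (c x)) \<and> 0 \<le> Limsup G (\<lambda>x. ereal (c x))"
    if "eventually (\<lambda>x. 0 < c x) G" for c :: "'a \<Rightarrow> real"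
  proof -
    have "0 \<le> Liminf G (\<lambda>x. ereal (c x))"
      using that by (intro Liminf_bounded) (auto elim: eventually_mono)
    then show ?thesis using Liminf_le_Limsup[OF nontriv] order_trans by blast
  qed
  show "0 \<le> Liminf G (\<lambda>x. ereal (a x))" "0 \<le> Limsup G (\<lambda>x. ereal (a x))"
    "0 \<le> Liminf G (\<lambda>x. ereal (b x))" "0 \<le> Limsup G (\<lambda>x. ereal (b x))"
    using *[OF apos] *[OF bpos] by auto
  have "eventually (\<lambda>x. 0 < a x / b x) G"
    using apos bpos by eventually_elim simp
  from *[OF this] show "0 \<le> Liminf G (\<lambda>x. ereal (a x / b x))"
    "0 \<le> Limsup G (\<lambda>x. ereal (a x / b x))" by auto
qed

lemma Liminf_divide_Limsup_le:
  assumes "determinate_quotient (Liminf G (\<lambda>x. ereal (a x))) (Limsup G (\<lambda>x. ereal (b x)))"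
  shows "Liminf G (\<lambda>x. ereal (a x)) / Limsup G (\<lambda>x. ereal (b x))
           \<le> Liminf G (\<lambda>x. ereal (a x / b x))"
proof (rule ccontr)
  assume "\<not> ?thesis"
  from ereal_between_of_not_le[OF this] obtain c where c: "Liminf G (\<lambda>x. ereal (a x / b x)) < ereal c"
    "ereal c < Liminf G (\<lambda>x. ereal (a x)) / Limsup G (\<lambda>x. ereal (b x))"
    by blast
  have "0 < c" using order.strict_trans1[OF nonneg(5) c(1)] by simp
  from separate_of_less_divide[OF this c(2) nonneg(1,4) assms] obtain u
    where u: "ereal u < Liminf G (\<lambda>x. ereal (a x))" "Limsup G (\<lambda>x. ereal (b x)) < ereal (u / c)" .
  have "eventually (\<lambda>x. ereal c \<le> ereal (a x / b x)) G"
    using less_LiminfD[OF u(1)] Limsup_lessD[OF u(2)] bpos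
    by eventually_elim (use \<open>0 < c\<close> in \<open>auto simp: field_simps\<close>)
  then have "ereal c \<le> Liminf G (\<lambda>x. ereal (a x / b x))" by (rule Liminf_bounded)
  with c(1) show False by simp
qed

lemma Liminf_le_Liminf_divide_Liminf:
  assumes "determinate_quotient (Liminf G (\<lambda>x. ereal (a x))) (Liminf G (\<lambda>x. ereal (b x)))"
  shows "Liminf G (\<lambda>x. ereal (a x / b x))
           \<le> Liminf G (\<lambda>x. ereal (a x)) / Liminf G (\<lambda>x. ereal (b x))"
proof (rule ccontr)
  assume "\<not> ?thesis"
  from ereal_between_of_not_le[OF this] obtain c where c: "ereal c < Liminf G (\<lambda>x. ereal (a x / b x))"
    "Liminf G (\<lambda>x. ereal (a x)) / Liminf G (\<lambda>x. ereal (b x)) < ereal c"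
    by blast
  have "0 \<le> Liminf G (\<lambda>x. ereal (a x)) / Liminf G (\<lambda>x. ereal (b x))"
    using nonneg by (intro ereal_divide_nonneg)
  from order.strict_trans1[OF this c(2)] have "0 < c" by simp
  from separate_of_divide_less[OF this c(2) nonneg(1,3) assms] obtain u
    where u: "Liminf G (\<lambda>x. ereal (a x)) < ereal u" "ereal (u / c) < Liminf G (\<lambda>x. ereal (b x))" .
  have "frequently (\<lambda>x. False) G"
    using frequently_less_of_Liminf_less[OF u(1)]
  proof (rule frequently_rev_mp)
    show "eventually (\<lambda>x. ereal (a x) < ereal u \<longrightarrow> False) G"
      using less_LiminfD[OF u(2)] bpos less_LiminfD[OF c(1)]
      by eventually_elim (use \<open>0 < c\<close> in \<open>auto simp: field_simps\<close>)
  qed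
  then show False by simp
qed

lemma Liminf_le_Limsup_divide_Limsup:
  assumes "determinate_quotient (Limsup G (\<lambda>x. ereal (a x))) (Limsup G (\<lambda>x. ereal (b x)))"
  shows "Liminf G (\<lambda>x. ereal (a x / b x))
           \<le> Limsup G (\<lambda>x. ereal (a x)) / Limsup G (\<lambda>x. ereal (b x))"
proof (rule ccontr)
  assume "\<not> ?thesis"
  from ereal_between_of_not_le[OF this] obtain c where c: "ereal c < Liminf G (\<lambda>x. ereal (a x / b x))"
    "Limsup G (\<lambda>x. ereal (a x)) / Limsup G (\<lambda>x. ereal (b x)) < ereal c"
    by blast
  have "0 \<le> Limsup G (\<lambda>x. ereal (a x)) / Limsup G (\<lambda>x. ereal (b x))"
    using nonneg by (intro ereal_divide_nonneg)
  from order.strict_trans1[OF this c(2)] have "0 < c" by simp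
  from separate_of_divide_less[OF this c(2) nonneg(2,4) assms] obtain u
    where u: "Limsup G (\<lambda>x. ereal (a x)) < ereal u" "ereal (u / c) < Limsup G (\<lambda>x. ereal (b x))" .
  have "frequently (\<lambda>x. False) G"
    using frequently_greater_of_less_Limsup[OF u(2)]
  proof (rule frequently_rev_mp)
    show "eventually (\<lambda>x. ereal (u / c) < ereal (b x) \<longrightarrow> False) G"
      using Limsup_lessD[OF u(1)] bpos less_LiminfD[OF c(1)]
      by eventually_elim (use \<open>0 < c\<close> in \<open>auto simp: field_simps\<close>)
  qed
  then show False by simp
qed

lemma Limsup_le_Limsup_divide_Liminf:
  assumes "determinate_quotient (Limsup G (\<lambda>x. ereal (a x))) (Liminf G (\<lambda>x. ereal (b x)))"
  shows "Limsup G (\<lambda>x. ereal (a x / b x))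
           \<le> Limsup G (\<lambda>x. ereal (a x)) / Liminf G (\<lambda>x. ereal (b x))"
proof (rule ccontr)
  assume "\<not> ?thesis"
  from ereal_between_of_not_le[OF this] obtain c where c: "ereal c < Limsup G (\<lambda>x. ereal (a x / b x))"
    "Limsup G (\<lambda>x. ereal (a x)) / Liminf G (\<lambda>x. ereal (b x)) < ereal c"
    by blast
  have "0 \<le> Limsup G (\<lambda>x. ereal (a x)) / Liminf G (\<lambda>x. ereal (b x))"
    using nonneg by (intro ereal_divide_nonneg)
  from order.strict_trans1[OF this c(2)] have "0 < c" by simp
  from separate_of_divide_less[OF this c(2) nonneg(2,3) assms] obtain u
    where u: "Limsup G (\<lambda>x. ereal (a x)) < ereal u" "ereal (u / c) < Liminf G (\<lambda>x. ereal (b x))" .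
  have "eventually (\<lambda>x. ereal (a x / b x) \<le> ereal c) G"
    using less_LiminfD[OF u(2)] Limsup_lessD[OF u(1)] bpos
    by eventually_elim (use \<open>0 < c\<close> in \<open>auto simp: field_simps\<close>)
  then have "Limsup G (\<lambda>x. ereal (a x / b x)) \<le> ereal c" by (rule Limsup_bounded)
  with c(1) show False by simp
qed

lemma Limsup_divide_Limsup_le:
  assumes "determinate_quotient (Limsup G (\<lambda>x. ereal (a x))) (Limsup G (\<lambda>x. ereal (b x)))"
  shows "Limsup G (\<lambda>x. ereal (a x)) / Limsup G (\<lambda>x. ereal (b x))
           \<le> Limsup G (\<lambda>x. ereal (a x / b x))"
proof (rule ccontr)
  assume "\<not> ?thesis"
  from ereal_between_of_not_le[OF this] obtain c where c: "Limsup G (\<lambda>x. ereal (a x / b x)) < ereal c"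
    "ereal c < Limsup G (\<lambda>x. ereal (a x)) / Limsup G (\<lambda>x. ereal (b x))"
    by blast
  have "0 < c" using order.strict_trans1[OF nonneg(6) c(1)] by simp
  from separate_of_less_divide[OF this c(2) nonneg(2,4) assms] obtain u
    where u: "ereal u < Limsup G (\<lambda>x. ereal (a x))" "Limsup G (\<lambda>x. ereal (b x)) < ereal (u / c)" .
  have "frequently (\<lambda>x. False) G"
    using frequently_greater_of_less_Limsup[OF u(1)]
  proof (rule frequently_rev_mp)
    show "eventually (\<lambda>x. ereal u < ereal (a x) \<longrightarrow> False) G"
      using Limsup_lessD[OF u(2)] bpos Limsup_lessD[OF c(1)]
      by eventually_elim (use \<open>0 < c\<close> in \<open>auto simp: field_simps\<close>)
  qed
  then show False by simp
qed

end

lemma ext_powr_less_iff: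
  assumes "0 \<le> x" "0 < a" "0 < c"
  shows "ext_powr x a < ereal c \<longleftrightarrow> x < ereal (c powr (1 / a))"
    and "ereal c < ext_powr x a \<longleftrightarrow> ereal (c powr (1 / a)) < x"
proof -
  have *: "(r powr a < c \<longleftrightarrow> r < c powr (1 / a)) \<and> (c < r powr a \<longleftrightarrow> c powr (1 / a) < r)"
    if "0 \<le> r" for r :: real
  proof -
    have c: "c = (c powr (1 / a)) powr a" using assms by (simp add: powr_powr)
    have "0 \<le> c powr (1 / a)" by simp
    then show ?thesis
      using that assms(2) powr_less_mono2[of a] powr_mono2[of a] c
      by (metis less_imp_le not_le)
  qed
  show "ext_powr x a < ereal c \<longleftrightarrow> x < ereal (c powr (1 / a))"
    and "ereal c < ext_powr x a \<longleftrightarrow> ereal (c powr (1 / a)) < x"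
    using assms(1) * by (cases x; simp add: ext_powr_def)+
qed

lemma ext_powr_nonneg: "0 \<le> ext_powr x a"
  by (simp add: ext_powr_def)

lemma ext_powr_mono:
  assumes "0 \<le> x" "x \<le> y" "0 \<le> a" shows "ext_powr x a \<le> ext_powr y a"
  using assms by (cases x; cases y) (auto simp: ext_powr_def powr_mono2)

text \<open>A power with positive exponent is an increasing continuous bijection of
  \<open>[0, \<infinity>]\<close>, so it commutes with lower limits, the value \<open>\<infinity>\<close> included.\<close>

lemma Liminf_ext_powr:
  fixes w :: "'a \<Rightarrow> real"
  assumes "0 < a" "eventually (\<lambda>x. 0 < w x) G"
  shows "Liminf G (\<lambda>x. ereal (w x powr a)) = ext_powr (Liminf G (\<lambda>x. ereal (w x))) a"
proof -
  have nonneg: "0 \<le> Liminf G (\<lambda>x. ereal (w x))"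
    using assms by (intro Liminf_bounded) (auto elim: eventually_mono)
  have nonneg': "0 \<le> Liminf G (\<lambda>x. ereal (w x powr a))"
    by (intro Liminf_bounded) auto
  have real_iff: "c < r powr a \<longleftrightarrow> c powr (1 / a) < r" if "0 < r" "0 < c" for r c
    using ext_powr_less_iff(2)[of "ereal r" a c] that assms(1) by (simp add: ext_powr_def)
  show ?thesis
  proof (rule antisym; rule ccontr)
    assume "\<not> Liminf G (\<lambda>x. ereal (w x powr a)) \<le> ext_powr (Liminf G (\<lambda>x. ereal (w x))) a"
    from ereal_between_of_not_le[OF this] obtain c where c: "ereal c < Liminf G (\<lambda>x. ereal (w x powr a))"
      "ext_powr (Liminf G (\<lambda>x. ereal (w x))) a < ereal c"
      by blast
    have "0 < c" using order.strict_trans1[OF ext_powr_nonneg c(2)] by simp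
    have "Liminf G (\<lambda>x. ereal (w x)) < ereal (c powr (1 / a))"
      using c(2) ext_powr_less_iff(1)[OF nonneg assms(1) \<open>0 < c\<close>] by simp
    moreover have "eventually (\<lambda>x. ereal (c powr (1 / a)) \<le> ereal (w x)) G"
      using less_LiminfD[OF c(1)] assms(2)
      by eventually_elim (simp add: real_iff \<open>0 < c\<close> less_imp_le)
    ultimately show False using Liminf_bounded[of _ "\<lambda>x. ereal (w x)" G] by (simp add: leD)
  next
    assume "\<not> ext_powr (Liminf G (\<lambda>x. ereal (w x))) a \<le> Liminf G (\<lambda>x. ereal (w x powr a))"
    from ereal_between_of_not_le[OF this] obtain c where c: "Liminf G (\<lambda>x. ereal (w x powr a)) < ereal c"
      "ereal c < ext_powr (Liminf G (\<lambda>x. ereal (w x))) a"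
      by blast
    have "0 < c" using order.strict_trans1[OF nonneg' c(1)] by simp
    have "ereal (c powr (1 / a)) < Liminf G (\<lambda>x. ereal (w x))"
      using c(2) ext_powr_less_iff(2)[OF nonneg assms(1) \<open>0 < c\<close>] by simp
    from less_LiminfD[OF this] assms(2)
    have "eventually (\<lambda>x. ereal c \<le> ereal (w x powr a)) G"
      by eventually_elim (simp add: real_iff \<open>0 < c\<close> less_imp_le)
    with c(1) show False using Liminf_bounded[of _ "\<lambda>x. ereal (w x powr a)" G] by (simp add: leD)
  qed
qed

section \<open>One function measured on two scales\<close>

lemma pos_finite_real:
  assumes "0 < e" "e < \<infinity>"
  obtains r where "e = ereal r" "0 < r"
  using assms by (cases e) auto

text \<open>Since \<open>ln y / ln x\<close> is the quotient of \<open>ln F / ln x\<close> by \<open>ln F / ln y\<close>, the order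
  of one scale with respect to the other is caught between quotients of the orders of \<open>F\<close>.\<close>

lemma Limsup_ln_scale_bounds:
  fixes F x y :: "'a \<Rightarrow> real"
  assumes nontriv: "G \<noteq> bot"
    and lims: "filterlim F at_top G" "filterlim x at_top G" "filterlim y at_top G"
    and rf: "Limsup G (\<lambda>R. ereal (ln (F R) / ln (x R))) = ereal rf" "0 < rf"
    and rg: "Limsup G (\<lambda>R. ereal (ln (F R) / ln (y R))) = ereal rg" "0 < rg"
    and lg: "Liminf G (\<lambda>R. ereal (ln (F R) / ln (y R))) = ereal lg" "0 < lg"
  obtains r where "Limsup G (\<lambda>R. ereal (ln (y R) / ln (x R))) = ereal r"
    "rf / rg \<le> r" "r \<le> rf / lg"
proof -
  let ?a = "\<lambda>R. ln (F R) / ln (x R)" and ?b = "\<lambda>R. ln (F R) / ln (y R)"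
  have gt1: "eventually (\<lambda>R. 1 < F R) G" "eventually (\<lambda>R. 1 < x R) G" "eventually (\<lambda>R. 1 < y R) G"
    using lims by (auto simp: filterlim_at_top_dense)
  have pos: "eventually (\<lambda>R. 0 < ?a R) G" "eventually (\<lambda>R. 0 < ?b R) G"
    using eventually_elim2[OF gt1(1,2), of "\<lambda>R. 0 < ?a R"]
      eventually_elim2[OF gt1(1,3), of "\<lambda>R. 0 < ?b R"] by auto
  have "eventually (\<lambda>R. ereal (?a R / ?b R) = ereal (ln (y R) / ln (x R))) G"
    using gt1 by eventually_elim (simp add: field_simps)
  then have quot: "Limsup G (\<lambda>R. ereal (?a R / ?b R)) = Limsup G (\<lambda>R. ereal (ln (y R) / ln (x R)))"
    by (rule Limsup_eq)
  have "ereal (rf / rg) \<le> Limsup G (\<lambda>R. ereal (ln (y R) / ln (x R)))"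
    using Limsup_divide_Limsup_le[OF nontriv pos] rf rg quot
    by (simp add: determinate_quotient_def)
  moreover have "Limsup G (\<lambda>R. ereal (ln (y R) / ln (x R))) \<le> ereal (rf / lg)"
    using Limsup_le_Limsup_divide_Liminf[OF nontriv pos] rf lg quot
    by (simp add: determinate_quotient_def)
  ultimately show ?thesis
    using that by (cases "Limsup G (\<lambda>R. ereal (ln (y R) / ln (x R)))") auto
qed

text \<open>Dividing \<open>F / x powr r\<close> by \<open>F / y powr s\<close> eliminates \<open>F\<close>, and the \<open>s\<close>-th root of
  the result is \<open>y / x powr (r / s)\<close>. As \<open>x > 1\<close> eventually, replacing the exponent
  \<open>r / s\<close> by \<open>t\<close> can only increase this quotient if \<open>t \<le> r / s\<close>, and only decrease it
  if \<open>r / s \<le> t\<close>.\<close>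

context
  fixes F x y :: "'a \<Rightarrow> real" and G :: "'a filter" and r s t :: real
  assumes nontriv: "G \<noteq> bot"
    and lims: "filterlim F at_top G" "filterlim x at_top G" "filterlim y at_top G"
    and s: "0 < s"
begin

private abbreviation (input) "a \<equiv> \<lambda>R. F R / x R powr r"
private abbreviation (input) "b \<equiv> \<lambda>R. F R / y R powr s"

private lemma scales_gt1:
  "eventually (\<lambda>R. 1 < F R) G" "eventually (\<lambda>R. 1 < x R) G" "eventually (\<lambda>R. 1 < y R) G"
  using lims by (auto simp: filterlim_at_top_dense)

private lemma scale_quotients_pos:
  "eventually (\<lambda>R. 0 < a R) G" "eventually (\<lambda>R. 0 < b R) G" "eventually (\<lambda>R. 0 < a R / b R) G"
proof -
  show "eventually (\<lambda>R. 0 < a R) G" using scales_gt1(1,2) by eventually_elim simp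
  show "eventually (\<lambda>R. 0 < b R) G" using scales_gt1(1,3) by eventually_elim simp
  show "eventually (\<lambda>R. 0 < a R / b R) G" using scales_gt1 by eventually_elim simp
qed

private lemma root_quotient:
  "eventually (\<lambda>R. (a R / b R) powr (1 / s) = y R / x R powr (r / s)) G"
  using scales_gt1
proof eventually_elim
  case (elim R)
  then have "a R / b R = y R powr s / x R powr r" by simp
  with elim s show ?case by (simp add: powr_divide powr_powr)
qed

private lemma Liminf_root_quotient:
  "ext_powr (Liminf G (\<lambda>R. ereal (a R / b R))) (1 / s)
     = Liminf G (\<lambda>R. ereal (y R / x R powr (r / s)))"
proof -
  have "ext_powr (Liminf G (\<lambda>R. ereal (a R / b R))) (1 / s)
      = Liminf G (\<lambda>R. ereal ((a R / b R) powr (1 / s)))"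
    by (rule Liminf_ext_powr[symmetric]) (use s scale_quotients_pos in auto)
  also have "\<dots> = Liminf G (\<lambda>R. ereal (y R / x R powr (r / s)))"
    by (rule Liminf_eq) (use root_quotient in \<open>auto elim: eventually_mono\<close>)
  finally show ?thesis .
qed

private lemma scale_limits_nonneg:
  "0 \<le> Liminf G (\<lambda>R. ereal (a R))" "0 \<le> Limsup G (\<lambda>R. ereal (b R))"
  "0 \<le> Liminf G (\<lambda>R. ereal (a R / b R))"
proof -
  show "0 \<le> Liminf G (\<lambda>R. ereal (a R))"
    using scale_quotients_pos(1) by (intro Liminf_bounded) (auto elim: eventually_mono)
  have "0 \<le> Liminf G (\<lambda>R. ereal (b R))"
    using scale_quotients_pos(2) by (intro Liminf_bounded) (auto elim: eventually_mono)
  then show "0 \<le> Limsup G (\<lambda>R. ereal (b R))"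
    using Liminf_le_Limsup[OF nontriv] order_trans by blast
  show "0 \<le> Liminf G (\<lambda>R. ereal (a R / b R))"
    using scale_quotients_pos(3) by (intro Liminf_bounded) (auto elim: eventually_mono)
qed

lemma scale_type_lower_bound:
  assumes "t \<le> r / s"
    and "determinate_quotient (Liminf G (\<lambda>R. ereal (F R / x R powr r)))
           (Limsup G (\<lambda>R. ereal (F R / y R powr s)))"
  shows "ext_powr (Liminf G (\<lambda>R. ereal (F R / x R powr r))
             / Limsup G (\<lambda>R. ereal (F R / y R powr s))) (1 / s)
           \<le> Liminf G (\<lambda>R. ereal (y R / x R powr t))"
proof -
  have "ext_powr (Liminf G (\<lambda>R. ereal (a R)) / Limsup G (\<lambda>R. ereal (b R))) (1 / s)
      \<le> ext_powr (Liminf G (\<lambda>R. ereal (a R / b R))) (1 / s)"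
    by (intro ext_powr_mono ereal_divide_nonneg scale_limits_nonneg
        Liminf_divide_Limsup_le[OF nontriv scale_quotients_pos(1,2) assms(2)]) (use s in simp)
  also have "\<dots> = Liminf G (\<lambda>R. ereal (y R / x R powr (r / s)))"
    by (rule Liminf_root_quotient)
  also have "\<dots> \<le> Liminf G (\<lambda>R. ereal (y R / x R powr t))"
  proof (rule Liminf_mono)
    show "eventually (\<lambda>R. ereal (y R / x R powr (r / s)) \<le> ereal (y R / x R powr t)) G"
      using scales_gt1(2,3)
      by eventually_elim (use assms(1) in \<open>auto intro!: divide_left_mono powr_mono\<close>)
  qed
  finally show ?thesis .
qed

private lemma Liminf_le_root_of_bound:
  assumes "r / s \<le> t" "Liminf G (\<lambda>R. ereal (a R / b R)) \<le> Q"
  shows "Liminf G (\<lambda>R. ereal (y R / x R powr t)) \<le> ext_powr Q (1 / s)"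
proof -
  have "Liminf G (\<lambda>R. ereal (y R / x R powr t)) \<le> Liminf G (\<lambda>R. ereal (y R / x R powr (r / s)))"
  proof (rule Liminf_mono)
    show "eventually (\<lambda>R. ereal (y R / x R powr t) \<le> ereal (y R / x R powr (r / s))) G"
      using scales_gt1(2,3)
      by eventually_elim (use assms(1) in \<open>auto intro!: divide_left_mono powr_mono\<close>)
  qed
  also have "\<dots> = ext_powr (Liminf G (\<lambda>R. ereal (a R / b R))) (1 / s)"
    by (rule Liminf_root_quotient[symmetric])
  also have "\<dots> \<le> ext_powr Q (1 / s)"
    using scale_limits_nonneg(3) assms(2) s by (intro ext_powr_mono) auto
  finally show ?thesis .
qed

lemma scale_type_upper_bound_Liminf:
  assumes "r / s \<le> t"
    and "determinate_quotient (Liminf G (\<lambda>R. ereal (F R / x R powr r)))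
           (Liminf G (\<lambda>R. ereal (F R / y R powr s)))"
  shows "Liminf G (\<lambda>R. ereal (y R / x R powr t))
           \<le> ext_powr (Liminf G (\<lambda>R. ereal (F R / x R powr r))
               / Liminf G (\<lambda>R. ereal (F R / y R powr s))) (1 / s)"
  using Liminf_le_root_of_bound[OF assms(1) Liminf_le_Liminf_divide_Liminf[OF nontriv scale_quotients_pos(1,2) assms(2)]] .

lemma scale_type_upper_bound_Limsup:
  assumes "r / s \<le> t"
    and "determinate_quotient (Limsup G (\<lambda>R. ereal (F R / x R powr r)))
           (Limsup G (\<lambda>R. ereal (F R / y R powr s)))"
  shows "Liminf G (\<lambda>R. ereal (y R / x R powr t))
           \<le> ext_powr (Limsup G (\<lambda>R. ereal (F R / x R powr r))
               / Limsup G (\<lambda>R. ereal (F R / y R powr s))) (1 / s)"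
  using Liminf_le_root_of_bound[OF assms(1) Liminf_le_Limsup_divide_Limsup[OF nontriv scale_quotients_pos(1,2) assms(2)]] .

end

section \<open>The maximum modulus over dilates of a circular domain\<close>

lemma bounded_linear_vector_scalar_mult_left: "bounded_linear (\<lambda>t. t *s (w :: complex ^ 'n))"
  unfolding linear_conv_bounded_linear[symmetric]
  by (rule linearI) (simp_all add: vec_eq_iff algebra_simps)

lemma bounded_linear_vector_scalar_mult_right: "bounded_linear (\<lambda>w :: complex ^ 'n. c *s w)"
  unfolding linear_conv_bounded_linear[symmetric]
  by (rule linearI) (simp_all add: vec_eq_iff algebra_simps)

lemma of_real_vector_scalar_mult: "of_real r *s (w :: complex ^ 'n) = r *\<^sub>R w"
  unfolding vec_eq_iff vector_smult_component vector_scaleR_component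
  by (simp add: scaleR_conv_of_real)

lemma entire_imp_continuous_on: "entire f \<Longrightarrow> continuous_on S f"
  unfolding entire_def
  by (meson continuous_at_imp_continuous_on has_derivative_continuous)

text \<open>Through restriction to complex lines, the maximum modulus principle and Liouville's
  theorem in one variable become available for entire functions of several variables.\<close>

lemma entire_holomorphic_on_line:
  assumes "entire f" shows "(\<lambda>t. f (t *s w)) holomorphic_on S"
proof -
  have "(\<lambda>t. f (t *s w)) field_differentiable (at t)" for t
  proof -
    obtain f' where f': "(f has_derivative f') (at (t *s w))" "\<And>c v. f' (c *s v) = c * f' v"
      using assms unfolding entire_def by blast
    have "((\<lambda>t. t *s w) has_derivative (\<lambda>h. h *s w)) (at t)"
      by (rule bounded_linear_imp_has_derivative[OF bounded_linear_vector_scalar_mult_left])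
    from diff_chain_at[OF this f'(1)]
    have "((\<lambda>t. f (t *s w)) has_derivative (\<lambda>h. h * f' w)) (at t)"
      by (simp add: o_def f'(2))
    then show ?thesis
      unfolding field_differentiable_def has_field_derivative_def
      by (intro exI[of _ "f' w"]) (simp add: mult.commute[of _ "f' w"])
  qed
  then show ?thesis
    by (auto simp: holomorphic_on_def intro: field_differentiable_at_within)
qed

lemma transcendental_entire_nonconstant:
  assumes "transcendental_entire f" shows "\<exists>z. f z \<noteq> f 0"
proof (rule ccontr)
  assume "\<not> ?thesis"
  then have "polynomial_map f"
    unfolding polynomial_map_def
    by (intro exI[of _ "{\<lambda>_. 0}"] exI[of _ "\<lambda>_. f 0"]) auto
  with assms show False by (simp add: transcendental_entire_def)
qed

lemma entire_bounded_imp_constant: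
  assumes "entire f" "\<And>z. norm (f z) \<le> B" shows "f z = f 0"
proof -
  have "(\<lambda>t. f (t *s z)) constant_on UNIV"
    by (rule Liouville_theorem[OF entire_holomorphic_on_line[OF assms(1)]])
      (use assms(2) in \<open>auto simp: bounded_iff\<close>)
  then obtain c where c: "\<And>t. f (t *s z) = c" by (auto simp: constant_on_def)
  from c[of 0] c[of 1] show ?thesis by simp
qed

context
  fixes D :: "(complex ^ 'n) set"
  assumes D: "bounded_complete_circular_domain D"
begin

lemma circular_domain_closure_compact: "compact (closure D)"
  using D by (simp add: bounded_complete_circular_domain_def)

lemma circular_domain_contains_ball: "\<exists>e>0. ball 0 e \<subseteq> D"
proof -
  obtain z where "z \<in> D" using D by (auto simp: bounded_complete_circular_domain_def)
  then have "0 \<in> D" using D unfolding bounded_complete_circular_domain_def by fastforce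
  then show ?thesis using D open_contains_ball by (auto simp: bounded_complete_circular_domain_def)
qed

lemma circular_domain_closure_scale:
  assumes "w \<in> closure D" "norm c \<le> 1" shows "c *s w \<in> closure D"
proof -
  have "(\<lambda>w. c *s w) ` closure D \<subseteq> closure D"
  proof (rule image_closure_subset)
    show "continuous_on (closure D) (\<lambda>w. c *s w)"
      using bounded_linear_vector_scalar_mult_right linear_continuous_on by blast
    have "c *s z \<in> D" if "z \<in> D" for z
    proof -
      have "\<forall>j. norm ((c *s z) $ j) \<le> norm (z $ j)"
        using assms(2) by (simp add: norm_mult mult_left_le_one_le)
      then show ?thesis using D that unfolding bounded_complete_circular_domain_def by blast
    qed
    then show "(\<lambda>w. c *s w) ` D \<subseteq> closure D" using closure_subset by blast
  qed simp
  with assms(1) show ?thesis by blast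
qed

context
  fixes f :: "complex ^ 'n \<Rightarrow> complex"
  assumes cont: "continuous_on UNIV f"
begin

text \<open>For continuous \<open>f\<close> the supremum over the open set \<open>D\<close> equals the maximum over the
  compact set \<open>closure D\<close>; having a point of attainment is what makes continuity and strict
  monotonicity accessible.\<close>

lemma max_mod_attained:
  assumes "0 < R"
  shows "\<exists>w\<in>closure D. max_mod f D R = norm (f (R *\<^sub>R w))" (is ?attained)
    and "w \<in> closure D \<Longrightarrow> norm (f (R *\<^sub>R w)) \<le> max_mod f D R"
proof -
  let ?\<phi> = "\<lambda>w. norm (f (R *\<^sub>R w))"
  have img: "{norm (f z) | z. z /\<^sub>R R \<in> D} = ?\<phi> ` D"
  proof safe
    fix z assume "z /\<^sub>R R \<in> D"
    then show "norm (f z) \<in> ?\<phi> ` D" using assms by (intro image_eqI[of _ _ "z /\<^sub>R R"]) auto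
  next
    fix w assume "w \<in> D"
    then show "\<exists>z. ?\<phi> w = norm (f z) \<and> z /\<^sub>R R \<in> D"
      using assms by (intro exI[of _ "R *\<^sub>R w"]) auto
  qed
  have cont\<phi>: "continuous_on (closure D) ?\<phi>"
    by (intro continuous_intros continuous_on_compose2[OF cont]) auto
  have ne: "D \<noteq> {}" using D by (simp add: bounded_complete_circular_domain_def)
  have bdd: "bdd_above (?\<phi> ` closure D)"
    by (intro bounded_imp_bdd_above compact_imp_bounded compact_continuous_image cont\<phi>
        circular_domain_closure_compact)
  have le: "?\<phi> w \<le> max_mod f D R" if "w \<in> closure D" for w
  proof (rule continuous_le_on_closure[OF cont\<phi> that])
    fix v assume "v \<in> D"
    then show "?\<phi> v \<le> max_mod f D R"
      unfolding max_mod_def img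
      by (intro cSUP_upper bdd_above_mono[OF bdd] image_mono closure_subset)
  qed
  then show "w \<in> closure D \<Longrightarrow> ?\<phi> w \<le> max_mod f D R" .
  obtain w where w: "w \<in> closure D" "\<And>v. v \<in> closure D \<Longrightarrow> ?\<phi> v \<le> ?\<phi> w"
    using continuous_attains_sup[OF circular_domain_closure_compact _ cont\<phi>] ne by auto
  have "max_mod f D R \<le> ?\<phi> w"
    unfolding max_mod_def img using ne w closure_subset by (intro cSUP_least) auto
  with le w show ?attained by (intro bexI[of _ w] antisym)
qed

lemma max_mod_mono:
  assumes "0 < R" "R \<le> S" shows "max_mod f D R \<le> max_mod f D S"
proof -
  obtain w where w: "w \<in> closure D" "max_mod f D R = norm (f (R *\<^sub>R w))"
    using max_mod_attained(1)[OF assms(1)] by blast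
  have "of_real (R / S) *s w \<in> closure D"
    by (rule circular_domain_closure_scale) (use w assms in \<open>auto simp: norm_divide\<close>)
  then have "(R / S) *\<^sub>R w \<in> closure D" by (simp only: of_real_vector_scalar_mult)
  from max_mod_attained(2)[OF _ this, of S] assms w(2) show ?thesis by simp
qed

text \<open>On a compact interval of radii, \<open>f (R *\<^sub>R w)\<close> is uniformly continuous jointly in \<open>R\<close>
  and \<open>w\<close>. Following a maximum point at radius \<open>R\<close> to a nearby radius \<open>S\<close> loses less than
  \<open>e\<close>, and the roles of \<open>R\<close> and \<open>S\<close> can be exchanged.\<close>

lemma continuous_on_max_mod: "continuous_on {0<..} (max_mod f D)"
proof -
  have "continuous_on {a<..<b} (max_mod f D)" if "0 < a" for a b
  proof -
    let ?\<psi> = "\<lambda>p. norm (f (fst p *\<^sub>R snd p))"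
    have "uniformly_continuous_on ({a..b} \<times> closure D) ?\<psi>"
      by (intro compact_uniformly_continuous compact_Times circular_domain_closure_compact
          continuous_intros continuous_on_compose2[OF cont]) auto
    then have unif: "\<exists>d>0. \<forall>p\<in>{a..b} \<times> closure D. \<forall>p'\<in>{a..b} \<times> closure D.
        dist p' p < d \<longrightarrow> dist (?\<psi> p') (?\<psi> p) < e" if "0 < e" for e
      using that unfolding uniformly_continuous_on_def by blast
    show ?thesis
    proof (rule uniformly_continuous_imp_continuous, unfold uniformly_continuous_on_def, intro allI impI)
      fix e :: real assume "0 < e"
      then obtain d where d: "0 < d" "\<And>p p'. p \<in> {a..b} \<times> closure D \<Longrightarrow> p' \<in> {a..b} \<times> closure D
          \<Longrightarrow> dist p' p < d \<Longrightarrow> dist (?\<psi> p') (?\<psi> p) < e" using unif by metis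
      have step: "max_mod f D R < max_mod f D S + e"
        if RS: "R \<in> {a<..<b}" "S \<in> {a<..<b}" "dist S R < d" for R S
      proof -
        have "0 < R" "0 < S" using RS \<open>0 < a\<close> by auto
        obtain w where w: "w \<in> closure D" "max_mod f D R = norm (f (R *\<^sub>R w))"
          using max_mod_attained(1)[OF \<open>0 < R\<close>] by blast
        have "dist (?\<psi> (S, w)) (?\<psi> (R, w)) < e"
          by (rule d(2)) (use w RS in \<open>auto simp: dist_Pair_Pair\<close>)
        with w max_mod_attained(2)[OF \<open>0 < S\<close> w(1)] show ?thesis by (simp add: dist_real_def)
      qed
      show "\<exists>d>0. \<forall>x\<in>{a<..<b}. \<forall>x'\<in>{a<..<b}. dist x' x < d
          \<longrightarrow> dist (max_mod f D x') (max_mod f D x) < e"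
      proof (intro exI[of _ d] conjI ballI impI)
        fix x x' assume "x \<in> {a<..<b}" "x' \<in> {a<..<b}" "dist x' x < d"
        with step[of x x'] step[of x' x] show "dist (max_mod f D x') (max_mod f D x) < e"
          by (simp add: dist_real_def dist_commute abs_less_iff)
      qed (rule d)
    qed
  qed
  then have "isCont (max_mod f D) R" if "0 < R" for R
    using that continuous_on_interior[of "{R/2<..<R+1}" "max_mod f D" R] by (simp add: interior_open)
  then show ?thesis by (intro continuous_at_imp_continuous_on) auto
qed

end

text \<open>If the maximum did not grow from \<open>R\<close> to \<open>S\<close>, the restriction of \<open>f\<close> to the line through
  a maximum point would have an interior maximum of its modulus, hence be constant, so that
  \<open>norm (f 0)\<close> is already the maximum at radius \<open>R\<close>. Then the restriction of \<open>f\<close> to every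
  line has an interior maximum at the origin, and \<open>f\<close> is constant.\<close>

lemma max_mod_strict_mono:
  assumes f: "transcendental_entire f"
  shows "strict_mono_on {0<..} (max_mod f D)"
proof (rule strict_mono_onI, rule ccontr)
  fix R S :: real assume R: "R \<in> {0<..}" and S: "S \<in> {0<..}" and RS: "R < S"
    and "\<not> max_mod f D R < max_mod f D S"
  then have le: "max_mod f D S \<le> max_mod f D R" by simp
  have ent: "entire f" using f by (simp add: transcendental_entire_def)
  note cont = entire_imp_continuous_on[OF ent, of UNIV]
  obtain w where w: "w \<in> closure D" "max_mod f D R = norm (f (R *\<^sub>R w))"
    using max_mod_attained(1)[OF cont] R by auto
  have "(\<lambda>t. f (t *s w)) constant_on UNIV"
  proof (rule maximum_modulus_principle[OF entire_holomorphic_on_line[OF ent]])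
    show "open (ball (0::complex) S)" "complex_of_real R \<in> ball 0 S" using R RS by auto
    fix t :: complex assume "t \<in> ball 0 S"
    then have "(t / of_real S) *s w \<in> closure D"
      using S w(1) by (intro circular_domain_closure_scale) (auto simp: norm_divide)
    from max_mod_attained(2)[OF cont _ this, of S] have "norm (f (t *s w)) \<le> max_mod f D S"
      using S by (simp flip: of_real_vector_scalar_mult)
    with le w(2) show "norm (f (t *s w)) \<le> norm (f (of_real R *s w))"
      by (simp add: of_real_vector_scalar_mult)
  qed auto
  then obtain c where c: "\<And>t. f (t *s w) = c" by (auto simp: constant_on_def)
  \<comment> \<open>The maximum over the dilate by \<open>R\<close> is attained at the origin.\<close>
  from c[of 0] c[of "of_real R"] w(2) have max0: "max_mod f D R = norm (f 0)"
    by (simp add: of_real_vector_scalar_mult)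
  obtain e where e: "0 < e" "ball 0 e \<subseteq> D" using circular_domain_contains_ball by blast
  obtain z where z: "f z \<noteq> f 0" using transcendental_entire_nonconstant[OF f] by blast
  have "z \<noteq> 0" using z by auto
  have "(\<lambda>t. f (t *s z)) constant_on UNIV"
  proof (rule maximum_modulus_principle[OF entire_holomorphic_on_line[OF ent]])
    show "open (ball (0::complex) (e * R / norm z))" "0 \<in> ball (0::complex) (e * R / norm z)"
      using e R \<open>z \<noteq> 0\<close> by auto
    fix t :: complex assume t: "t \<in> ball 0 (e * R / norm z)"
    have "norm (t *s z) = norm t * norm z"
      by (simp add: norm_vec_def L2_set_right_distrib norm_mult)
    with t e R \<open>z \<noteq> 0\<close> have "norm ((t *s z) /\<^sub>R R) < e" by (simp add: field_simps)
    with e have "(t *s z) /\<^sub>R R \<in> closure D" by (intro subsetD[OF closure_subset] subsetD[OF e(2)]) simp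
    from max_mod_attained(2)[OF cont _ this, of R] R max0
    show "norm (f (t *s z)) \<le> norm (f (0 *s z))" by simp
  qed auto
  then obtain c' where "\<And>t. f (t *s z) = c'" by (auto simp: constant_on_def)
  from this[of 0] this[of 1] z show False by simp
qed

lemma max_mod_at_top:
  assumes f: "transcendental_entire f"
  shows "filterlim (max_mod f D) at_top at_top"
proof -
  have ent: "entire f" using f by (simp add: transcendental_entire_def)
  note cont = entire_imp_continuous_on[OF ent, of UNIV]
  have "\<exists>R>0. B < max_mod f D R" for B
  proof (rule ccontr)
    assume "\<not> ?thesis"
    then have le: "max_mod f D R \<le> B" if "0 < R" for R using that by (meson not_le)
    obtain e where e: "0 < e" "ball 0 e \<subseteq> D" using circular_domain_contains_ball by blast
    have "norm (f z) \<le> B" for z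
    proof -
      \<comment> \<open>The radius is chosen so that \<open>z / R\<close> lies in the ball of radius \<open>e\<close>.\<close>
      define R where "R = norm z / e + 1"
      have R: "0 < R" unfolding R_def using e by (simp add: add_nonneg_pos)
      have "norm (z /\<^sub>R R) < e" using R e by (simp add: R_def field_simps)
      with e have "z /\<^sub>R R \<in> closure D" by (intro subsetD[OF closure_subset] subsetD[OF e(2)]) simp
      from max_mod_attained(2)[OF cont R this] le[OF R] R show ?thesis by simp
    qed
    with entire_bounded_imp_constant[OF ent] transcendental_entire_nonconstant[OF f]
    show False by blast
  qed
  then show ?thesis
    unfolding filterlim_at_top_dense eventually_at_top_linorder
    by (meson max_mod_mono[OF cont] less_le_trans)
qed

end

section \<open>Change of variable between two growth functions\<close>

text \<open>The properties of a maximum modulus that make \<open>the_inv_into {0<..} B \<circ> A\<close> a change of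
  variable near infinity.\<close>

definition growth_function :: "(real \<Rightarrow> real) \<Rightarrow> bool" where
  "growth_function A \<longleftrightarrow>
     strict_mono_on {0<..} A \<and> continuous_on {0<..} A \<and> filterlim A at_top at_top"

lemma growth_function_max_mod:
  assumes "transcendental_entire f" "bounded_complete_circular_domain D"
  shows "growth_function (max_mod f D)"
  using assms
  by (simp add: growth_function_def max_mod_strict_mono max_mod_at_top continuous_on_max_mod
      entire_imp_continuous_on transcendental_entire_def)

lemma growth_function_inj_on: "growth_function A \<Longrightarrow> inj_on A {0<..}"
  by (auto simp: growth_function_def intro: strict_mono_on_imp_inj_on)

lemma growth_function_attains:
  assumes "growth_function A" "A 1 < v" shows "\<exists>s>0. A s = v"
proof -
  have "eventually (\<lambda>R. v \<le> A R \<and> 1 \<le> R) at_top"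
    using assms(1) by (intro eventually_conj eventually_ge_at_top)
      (auto simp: growth_function_def filterlim_at_top)
  then obtain R where "v \<le> A R" "1 \<le> R" using eventually_happens'[OF trivial_limit_at_top_linorder] by blast
  moreover have "continuous_on {1..R} A"
    using assms(1) by (auto simp: growth_function_def intro: continuous_on_subset)
  ultimately obtain s where "1 \<le> s" "A s = v" using IVT'[of A 1 v R] assms(2) by auto
  then show ?thesis by (intro exI[of _ s]) auto
qed

context
  fixes A B :: "real \<Rightarrow> real"
  assumes A: "growth_function A" and B: "growth_function B"
begin

lemma transition_solves:
  "eventually (\<lambda>R. 0 < the_inv_into {0<..} B (A R) \<and> B (the_inv_into {0<..} B (A R)) = A R) at_top"
proof -
  have "eventually (\<lambda>R. B 1 < A R) at_top"
    using A by (auto simp: growth_function_def filterlim_at_top_dense)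
  then show ?thesis
  proof eventually_elim
    case (elim R)
    then obtain s where "0 < s" "B s = A R" using growth_function_attains[OF B] by blast
    moreover from this have "the_inv_into {0<..} B (A R) = s"
      using growth_function_inj_on[OF B] by (intro the_inv_into_f_eq) auto
    ultimately show ?case by simp
  qed
qed

lemma transition_at_top: "filterlim (\<lambda>R. the_inv_into {0<..} B (A R)) at_top at_top"
  unfolding filterlim_at_top_dense
proof
  fix C :: real
  have "eventually (\<lambda>R. B (max C 1) < A R) at_top"
    using A by (auto simp: growth_function_def filterlim_at_top_dense)
  with transition_solves show "eventually (\<lambda>R. C < the_inv_into {0<..} B (A R)) at_top"
  proof eventually_elim
    case (elim R)
    have "strict_mono_on {0<..} B" using B by (simp add: growth_function_def)
    then have "max C 1 < the_inv_into {0<..} B (A R)"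
      using elim by (subst strict_mono_on_less[symmetric]) auto
    then show ?case by simp
  qed
qed

end

text \<open>The transition from \<open>A\<close> to \<open>B\<close> is inverted near infinity by the transition from \<open>B\<close>
  to \<open>A\<close>. Divergence to infinity alone would give only inequalities between limits over its
  argument and limits over its value; equality of filters gives equality of upper and of lower
  limits.\<close>

lemma filtermap_transition:
  assumes "growth_function A" "growth_function B"
  shows "filtermap (\<lambda>R. the_inv_into {0<..} B (A R)) at_top = at_top"
proof (rule filtermap_fun_inverse)
  let ?k = "\<lambda>s. the_inv_into {0<..} A (B s)"
  show "filterlim ?k at_top at_top" "filterlim (\<lambda>R. the_inv_into {0<..} B (A R)) at_top at_top"
    by (rule transition_at_top assms)+
  show "eventually (\<lambda>s. the_inv_into {0<..} B (A (?k s)) = s) at_top"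
    using transition_solves[OF assms(2,1)] eventually_gt_at_top[of 0]
    by eventually_elim (simp add: the_inv_into_f_f growth_function_inj_on[OF assms(2)])
qed

section \<open>Iterated logarithms and index-pairs\<close>

lemma iter_log_at_top: "filterlim (iter_log k) at_top at_top"
proof (induction k)
  case 0
  then show ?case by (simp add: iter_log_def id_def filterlim_ident)
next
  case (Suc k)
  have "iter_log (Suc k) = (\<lambda>x. ln (iter_log k x))" by (simp add: iter_log_def fun_eq_iff)
  then show ?case using filterlim_compose[OF ln_at_top Suc] by simp
qed

lemma iter_log_eq_ln: "1 \<le> k \<Longrightarrow> iter_log k x = ln (iter_log (k - 1) x)"
  by (cases k) (simp_all add: iter_log_def)

text \<open>In either clause of the definition the order of the index-pair itself is positive and
  finite, which is all that the bounds take from it.\<close>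

lemma has_index_pair_growth_order:
  assumes "has_index_pair f D m q"
  shows "0 < growth_order f D m q" "growth_order f D m q < \<infinity>"
proof -
  have "0 < growth_order f D m q \<and> growth_order f D m q < \<infinity>"
  proof (cases "pos_finite (growth_order f D 1 1)")
    case True
    then show ?thesis using assms by (simp add: has_index_pair_def pos_finite_def)
  next
    case False
    then show ?thesis using assms
      by (auto simp: has_index_pair_def split: if_splits intro: less_trans[of 0 "1 :: ereal"])
  qed
  then show "0 < growth_order f D m q" "growth_order f D m q < \<infinity>" by auto
qed

section \<open>Relative lower type and types of entire functions\<close>

theorem theorem7:
  fixes f g :: "complex ^ 'n \<Rightarrow> complex"
    and D :: "(complex ^ 'n) set"
    and m p q :: nat
  assumes "transcendental_entire f" and "transcendental_entire g"
    and "bounded_complete_circular_domain D"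
    and "m \<ge> q" and "q \<ge> 1" and "m \<ge> p" and "p \<ge> 1"
    and "has_index_pair f D m q" and "has_index_pair g D m p"
    and "growth_lower_order g D m p > 0"
  shows "(determinate_quotient (type_Delta_bar f D m q) (type_tau_bar g D m p) \<longrightarrow>
            ext_powr (type_Delta_bar f D m q / type_tau_bar g D m p)
              (1 / real_of_ereal (growth_lower_order g D m p))
            \<le> rel_type_Delta_bar g D p q f) \<and>
         (determinate_quotient (type_Delta_bar f D m q) (type_Delta_bar g D m p) \<longrightarrow>
            rel_type_Delta_bar g D p q f
            \<le> ext_powr (type_Delta_bar f D m q / type_Delta_bar g D m p)
                (1 / real_of_ereal (growth_order g D m p))) \<and>
         (determinate_quotient (type_Delta f D m q) (type_Delta g D m p) \<longrightarrow>
            rel_type_Delta_bar g D p q f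
            \<le> ext_powr (type_Delta f D m q / type_Delta g D m p)
                (1 / real_of_ereal (growth_order g D m p)))"
proof -
  note growth_f = growth_function_max_mod[OF assms(1,3)]
  note growth_g = growth_function_max_mod[OF assms(2,3)]
  define h where "h R = max_mod_inv g D (max_mod f D R)" for R
  define F where "F R = iter_log (m - 1) (max_mod f D R)" for R
  define x where "x = iter_log (q - 1)"
  define y where "y R = iter_log (p - 1) (h R)" for R
  have m: "1 \<le> m" using assms(4,5) by simp

  have h_eq: "h = (\<lambda>R. the_inv_into {0<..} (max_mod g D) (max_mod f D R))"
    by (simp add: h_def max_mod_inv_def fun_eq_iff)
  have h_lim: "filterlim h at_top at_top"
    unfolding h_eq by (rule transition_at_top[OF growth_f growth_g])
  have gh: "eventually (\<lambda>R. max_mod g D (h R) = max_mod f D R) at_top"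
    using transition_solves[OF growth_f growth_g] unfolding h_eq by (auto elim: eventually_mono)
  have filt: "filtermap h at_top = at_top"
    unfolding h_eq by (rule filtermap_transition[OF growth_f growth_g])

  have F_lim: "filterlim F at_top at_top"
    unfolding F_def using growth_f
    by (intro filterlim_compose[OF iter_log_at_top]) (simp add: growth_function_def)
  have x_lim: "filterlim x at_top at_top" unfolding x_def by (rule iter_log_at_top)
  have y_lim: "filterlim y at_top at_top"
    unfolding y_def by (rule filterlim_compose[OF iter_log_at_top h_lim])
  note lims = F_lim x_lim y_lim

  have order_f: "growth_order f D m q = Limsup at_top (\<lambda>R. ereal (ln (F R) / ln (x R)))"
    using m assms(5) by (simp add: growth_order_def F_def x_def iter_log_eq_ln)
  have rel: "rel_order g D p q f = Limsup at_top (\<lambda>R. ereal (ln (y R) / ln (x R)))"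
    using assms(5,7) by (simp add: rel_order_def y_def x_def h_def iter_log_eq_ln)
  \<comment> \<open>The limits that define the growth of \<open>g\<close> run over the radius of \<open>g\<close>. Evaluated at
    \<open>h R\<close>, where \<open>g\<close> has the maximum modulus of \<open>f\<close> at \<open>R\<close>, they become limits over \<open>R\<close>.\<close>
  have g_quot: "eventually (\<lambda>R. ereal (iter_log m (max_mod g D (h R)) / iter_log p (h R))
      = ereal (ln (F R) / ln (y R))) at_top"
    using gh by eventually_elim (use m assms(7) in \<open>simp add: F_def y_def iter_log_eq_ln\<close>)
  have order_g: "growth_order g D m p = Limsup at_top (\<lambda>R. ereal (ln (F R) / ln (y R)))"
    unfolding growth_order_def
    by (subst filt[symmetric], subst Limsup_filtermap_ereal) (rule Limsup_eq[OF g_quot])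
  have lower_order_g:
    "growth_lower_order g D m p = Liminf at_top (\<lambda>R. ereal (ln (F R) / ln (y R)))"
    unfolding growth_lower_order_def
    by (subst filt[symmetric], subst Liminf_filtermap_ereal) (rule Liminf_eq[OF g_quot])

  obtain rf where rf: "growth_order f D m q = ereal rf" "0 < rf"
    using has_index_pair_growth_order[OF assms(8)] by (rule pos_finite_real)
  obtain rg where rg: "growth_order g D m p = ereal rg" "0 < rg"
    using has_index_pair_growth_order[OF assms(9)] by (rule pos_finite_real)
  have "growth_lower_order g D m p \<le> growth_order g D m p"
    unfolding growth_lower_order_def growth_order_def by (rule Liminf_le_Limsup) simp
  then have "growth_lower_order g D m p < \<infinity>" using rg by auto
  with assms(10) obtain lg where lg: "growth_lower_order g D m p = ereal lg" "0 < lg"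
    by (rule pos_finite_real)
  obtain r where r: "rel_order g D p q f = ereal r" "rf / rg \<le> r" "r \<le> rf / lg"
    unfolding rel
    by (rule Limsup_ln_scale_bounds[OF trivial_limit_at_top_linorder lims
          rf(1)[unfolded order_f] rf(2) rg(1)[unfolded order_g] rg(2)
          lg(1)[unfolded lower_order_g] lg(2)])

  have type_f: "type_quotient f D m q a = (\<lambda>R. ereal (F R / x R powr a))" for a
    by (simp add: type_quotient_def F_def x_def fun_eq_iff)
  have g_type: "eventually (\<lambda>R. type_quotient g D m p a (h R) = ereal (F R / y R powr a)) at_top"
    for a
    using gh by eventually_elim (simp add: type_quotient_def F_def y_def)
  have Limsup_g: "Limsup at_top (type_quotient g D m p a)
      = Limsup at_top (\<lambda>R. ereal (F R / y R powr a))" for a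
    by (subst filt[symmetric], subst Limsup_filtermap_ereal) (rule Limsup_eq[OF g_type])
  have Liminf_g: "Liminf at_top (type_quotient g D m p a)
      = Liminf at_top (\<lambda>R. ereal (F R / y R powr a))" for a
    by (subst filt[symmetric], subst Liminf_filtermap_ereal) (rule Liminf_eq[OF g_type])
  have types: "type_Delta_bar f D m q = Liminf at_top (\<lambda>R. ereal (F R / x R powr rf))"
    "type_Delta f D m q = Limsup at_top (\<lambda>R. ereal (F R / x R powr rf))"
    "type_Delta_bar g D m p = Liminf at_top (\<lambda>R. ereal (F R / y R powr rg))"
    "type_Delta g D m p = Limsup at_top (\<lambda>R. ereal (F R / y R powr rg))"
    "type_tau_bar g D m p = Limsup at_top (\<lambda>R. ereal (F R / y R powr lg))"
    "rel_type_Delta_bar g D p q f = Liminf at_top (\<lambda>R. ereal (y R / x R powr r))"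
    using rf rg lg r
    by (simp_all add: type_Delta_bar_def type_Delta_def type_tau_bar_def rel_type_Delta_bar_def
        type_f Limsup_g Liminf_g y_def x_def h_def)
  show ?thesis
    unfolding types rg(1) lg(1) real_of_ereal.simps
    using scale_type_lower_bound[OF trivial_limit_at_top_linorder lims lg(2) r(3)]
      scale_type_upper_bound_Liminf[OF trivial_limit_at_top_linorder lims rg(2) r(2)]
      scale_type_upper_bound_Limsup[OF trivial_limit_at_top_linorder lims rg(2) r(2)]
    by blast
qed

end
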